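(* Let $\alpha\in(0,1)$, let $P_k(y)$, $k\in[K]$, be the cross-conformal p-value functions built from $K$ folds of equal size $m=n/K$ and a symmetric score function $s$ as defined in the context, let $U$ be a uniform random variable on $(0,1)$ independent of all the data, and let $$\hat C^{\mathrm{mod\text{-}cross}}_{n,K,\alpha}(X_{n+1})=\Big\{y\in\mathcal Y:\ \frac1K\sum_{k=1}^K P_k(y)>\alpha\Big\},$$ $$\hat C^{\mathrm{u\text{-}mod\text{-}cross}}_{n,K,\alpha}(X_{n+1})=\Big\{y\in\mathcal Y:\ \frac{1}{2-U}\,\frac1K\sum_{k=1}^{K} P_k(y)>\alpha\Big\}.$$ Then $\hat C^{\mathrm{u\text{-}mod\text{-}cross}}_{n,K,\alpha}(X_{n+1})\subseteq \hat C^{\mathrm{mod\text{-}cross}}_{n,K,\alpha}(X_{n+1})$. In addition, if the data $(X_1,Y_1),\dots,(X_{n+1},Y_{n+1})$ are exchangeable, then $$\mathbb P\big(Y_{n+1}\in \hat C^{\mathrm{u\text{-}mod\text{-}cross}}_{n,K,\alpha}(X_{n+1})\big)\ge 1-2\alpha .$$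
   Context: Write $[d]=\{1,\dots,d\}$. Data points $Z_i=(X_i,Y_i)$, $i\in[n+1]$, are random elements of $\mathcal X\times\mathcal Y$ (measurable spaces); the first $n$ are training points and $(X_{n+1},Y_{n+1})$ is the test point. For $I\subseteq[n]$ let $\mathcal D_I=(Z_i: i\in I)$. Score function: $s((x,y);\mathcal D)\in\mathbb R$ is a (measurable) function defined for $(x,y)\in\mathcal X\times\mathcal Y$ and any finite dataset $\mathcal D\in\bigcup_{d\ge1}(\mathcal X\times\mathcal Y)^d$, and it is symmetric in the dataset: $s((x,y);\mathcal D)=s((x,y);\mathcal D^\pi)$ for every $\mathcal D\in(\mathcal X\times\mathcal Y)^d$ and every permutation $\pi$ of $[d]$, where $\mathcal D^\pi$ is $\mathcal D$ with its elements permuted by $\pi$. Folds: $[n]$ is partitioned into $K\ge2$ disjoint folds $I_1,\dots,I_K$ (chosen independently of the data), each of size $m=n/K$, which is assumed to be an integer. For $i\in[n]$, $k(i)$ is the index of the fold containing $i$, and $S_i^{\mathrm{CV}}=s\big((X_i,Y_i);\mathcal D_{[n]\setminus I_{k(i)}}\big)$. Cross-conformal p-values: for $k\in[K]$ and $y\in\mathcal Y$, $$P_k(y)=\frac{1+\sum_{i\in I_k}\mathbf 1\{s((X_{n+1},y);\mathcal D_{[n]\setminus I_k})\le S_i^{\mathrm{CV}}\}}{m+1}.$$ Exchangeable means that the joint distribution is invariant under every permutation of the indices. The probability is over all data $(X_1,Y_1),\dots,(X_{n+1},Y_{n+1})$ and $U$ (which is independent of the data and the folds). *)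

theory Defs
  imports "HOL-Probability.Probability" "HOL-Combinatorics.Combinatorics"
begin

text \<open>Data are functions \<open>z :: nat \<Rightarrow> 'x \<times> 'y\<close>, read on the indices \<open>1, \<dots>, n + 1\<close>; a dataset is a
  list. The observations with indices in a finite set \<open>J\<close> are listed by increasing index, a choice
  that is immaterial for a symmetric score.\<close>

definition dataset :: "(nat \<Rightarrow> 'z) \<Rightarrow> nat set \<Rightarrow> 'z list" where
  "dataset z J = map z (sorted_list_of_set J)"

text \<open>Measurability is required separately for each dataset size \<open>d \<ge> 1\<close>, with the datasets of size
  \<open>d\<close> presented as the product space over the indices \<open>0, \<dots>, d - 1\<close>. Nothing is required of the
  value on the empty list.\<close>

definition score_measurable ::
    "'x measure \<Rightarrow> 'y measure \<Rightarrow> ('x \<times> 'y \<Rightarrow> ('x \<times> 'y) list \<Rightarrow> real) \<Rightarrow> bool" where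
  "score_measurable MX MY s \<longleftrightarrow>
     (\<forall>d\<ge>1. (\<lambda>(p, w). s p (map w [0..<d]))
        \<in> borel_measurable ((MX \<Otimes>\<^sub>M MY) \<Otimes>\<^sub>M (\<Pi>\<^sub>M i\<in>{0..<d}. MX \<Otimes>\<^sub>M MY)))"

definition score_symmetric ::
    "'x measure \<Rightarrow> 'y measure \<Rightarrow> ('x \<times> 'y \<Rightarrow> ('x \<times> 'y) list \<Rightarrow> real) \<Rightarrow> bool" where
  "score_symmetric MX MY s \<longleftrightarrow>
     (\<forall>p \<in> space MX \<times> space MY. \<forall>D \<in> lists (space MX \<times> space MY). \<forall>\<pi>.
        D \<noteq> [] \<longrightarrow> \<pi> permutes {..<length D} \<longrightarrow> s p (permute_list \<pi> D) = s p D)"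

definition equal_folds :: "nat \<Rightarrow> nat \<Rightarrow> (nat \<Rightarrow> nat set) \<Rightarrow> bool" where
  "equal_folds n K I \<longleftrightarrow>
     disjoint_family_on I {1..K} \<and> (\<Union>k\<in>{1..K}. I k) = {1..n} \<and>
     (\<forall>k\<in>{1..K}. card (I k) = n div K)"

definition fold_index :: "nat \<Rightarrow> (nat \<Rightarrow> nat set) \<Rightarrow> nat \<Rightarrow> nat" where
  "fold_index K I i = (THE k. k \<in> {1..K} \<and> i \<in> I k)"

definition cv_score ::
    "('x \<times> 'y \<Rightarrow> ('x \<times> 'y) list \<Rightarrow> real) \<Rightarrow> nat \<Rightarrow> nat \<Rightarrow> (nat \<Rightarrow> nat set) \<Rightarrow>
     (nat \<Rightarrow> 'x \<times> 'y) \<Rightarrow> nat \<Rightarrow> real" where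
  "cv_score s n K I z i = s (z i) (dataset z ({1..n} - I (fold_index K I i)))"

text \<open>The functions below use only the first component of \<open>z (n + 1)\<close>, the test covariate.\<close>

definition cross_pvalue ::
    "('x \<times> 'y \<Rightarrow> ('x \<times> 'y) list \<Rightarrow> real) \<Rightarrow> nat \<Rightarrow> nat \<Rightarrow> (nat \<Rightarrow> nat set) \<Rightarrow>
     (nat \<Rightarrow> 'x \<times> 'y) \<Rightarrow> nat \<Rightarrow> 'y \<Rightarrow> real" where
  "cross_pvalue s n K I z k y =
     (1 + (\<Sum>i\<in>I k. of_bool (s (fst (z (n + 1)), y) (dataset z ({1..n} - I k))
                            \<le> cv_score s n K I z i)))
     / (real (n div K) + 1)"

definition mod_cross_set ::
    "'y measure \<Rightarrow> ('x \<times> 'y \<Rightarrow> ('x \<times> 'y) list \<Rightarrow> real) \<Rightarrow> nat \<Rightarrow> nat \<Rightarrow> real \<Rightarrow>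
     (nat \<Rightarrow> nat set) \<Rightarrow> (nat \<Rightarrow> 'x \<times> 'y) \<Rightarrow> 'y set" where
  "mod_cross_set MY s n K \<alpha> I z =
     {y \<in> space MY. 1 / real K * (\<Sum>k = 1..K. cross_pvalue s n K I z k y) > \<alpha>}"

definition u_mod_cross_set ::
    "'y measure \<Rightarrow> ('x \<times> 'y \<Rightarrow> ('x \<times> 'y) list \<Rightarrow> real) \<Rightarrow> nat \<Rightarrow> nat \<Rightarrow> real \<Rightarrow>
     (nat \<Rightarrow> nat set) \<Rightarrow> (nat \<Rightarrow> 'x \<times> 'y) \<Rightarrow> real \<Rightarrow> 'y set" where
  "u_mod_cross_set MY s n K \<alpha> I z u =
     {y \<in> space MY.
        1 / (2 - u) * (1 / real K * (\<Sum>k = 1..K. cross_pvalue s n K I z k y)) > \<alpha>}"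

definition exchangeable ::
    "'w measure \<Rightarrow> 'z measure \<Rightarrow> nat set \<Rightarrow> (nat \<Rightarrow> 'w \<Rightarrow> 'z) \<Rightarrow> bool" where
  "exchangeable M N J Z \<longleftrightarrow>
     (\<forall>\<pi>. \<pi> permutes J \<longrightarrow>
        distr M (\<Pi>\<^sub>M i\<in>J. N) (\<lambda>\<omega>. \<lambda>i\<in>J. Z (\<pi> i) \<omega>) =
        distr M (\<Pi>\<^sub>M i\<in>J. N) (\<lambda>\<omega>. \<lambda>i\<in>J. Z i \<omega>))"

text \<open>Independence of two random elements of possibly different types; the library's \<open>indep_var\<close>
  forces both to have the same type. This is the right-hand side of \<open>indep_var_eq\<close>, the inverse
  images of a \<open>\<sigma>\<close>-algebra being a \<open>\<sigma>\<close>-algebra already.\<close>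

definition indep_elements ::
    "'w measure \<Rightarrow> 'a measure \<Rightarrow> ('w \<Rightarrow> 'a) \<Rightarrow> 'b measure \<Rightarrow> ('w \<Rightarrow> 'b) \<Rightarrow> bool" where
  "indep_elements M S A T B \<longleftrightarrow>
     A \<in> measurable M S \<and> B \<in> measurable M T \<and>
     prob_space.indep_set M
       {A -` E \<inter> space M | E. E \<in> sets S} {B -` F \<inter> space M | F. F \<in> sets T}"

abbreviation data_space :: "'x measure \<Rightarrow> 'y measure \<Rightarrow> nat \<Rightarrow> (nat \<Rightarrow> 'x \<times> 'y) measure" where
  "data_space MX MY n \<equiv> (\<Pi>\<^sub>M i\<in>{1..n + 1}. MX \<Otimes>\<^sub>M MY)"

abbreviation fold_space :: "nat \<Rightarrow> nat \<Rightarrow> (nat \<Rightarrow> nat set) measure" where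
  "fold_space n K \<equiv> (\<Pi>\<^sub>M k\<in>{1..K}. count_space (Pow {1..n}))"

end

theory Submission
  imports Defs
begin

text \<open>Write \<open>h p = max 0 (2 - p / \<alpha>)\<close>. Given the data and the folds, miscoverage is the event that
  the mean p-value is at most \<open>\<alpha> (2 - U)\<close>, whose conditional probability is at most \<open>h\<close> of the mean
  p-value. Unlike the conditional probability itself, \<open>h\<close> is convex, so it is bounded by the mean
  of the \<open>h (P\<^sub>k)\<close>. By exchangeability the expectation of \<open>h (P\<^sub>k)\<close> is unchanged when the test
  point trades places with a point of fold \<open>k\<close>; averaging over these swaps turns it into an average of
  \<open>h\<close> over ranks among \<open>m + 1\<close> scores, at most \<open>(\<Sum>r = 1..m + 1. h (r / (m + 1))) / (m + 1)\<close>, a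
  lower Riemann sum of \<open>\<integral> h = 2 * \<alpha>\<close> over the positive half-line.\<close>

section \<open>Ranks of finitely many scores\<close>

text \<open>Without ties the counts are exactly \<open>1\<close>, ..., \<open>card J\<close>; ties
  only enlarge them, which lowers an antitone \<open>\<phi>\<close>. The induction removes a point
  of minimal score: its count is all of \<open>J\<close>, and no other count grows when it
  leaves.\<close>

lemma sum_rank_le:
  fixes \<sigma> :: "'i \<Rightarrow> 'b::linorder" and \<phi> :: "nat \<Rightarrow> real"
  assumes "finite J" and "antimono \<phi>"
  shows "(\<Sum>j\<in>J. \<phi> (card {i \<in> J. \<sigma> j \<le> \<sigma> i})) \<le> (\<Sum>r = 1..card J. \<phi> r)"
  using \<open>finite J\<close>
proof (induction J rule: finite_remove_induct)
  case empty
  then show ?case by simp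
next
  case (remove J)
  obtain j where j: "j \<in> J" "\<And>i. i \<in> J \<Longrightarrow> \<sigma> j \<le> \<sigma> i"
    using remove(1,2) arg_min_if_finite(1)[of J \<sigma>] arg_min_least[of J _ \<sigma>] by metis
  have top: "{i \<in> J. \<sigma> j \<le> \<sigma> i} = J" using j by auto
  have card: "card J = Suc (card (J - {j}))"
    using remove(1) j(1) by (metis card.remove)
  have "(\<Sum>l\<in>J. \<phi> (card {i \<in> J. \<sigma> l \<le> \<sigma> i}))
      = \<phi> (card J) + (\<Sum>l\<in>J - {j}. \<phi> (card {i \<in> J. \<sigma> l \<le> \<sigma> i}))"
    using remove(1) j(1) top by (simp add: sum.remove)
  also have "\<dots> \<le> \<phi> (card J) + (\<Sum>l\<in>J - {j}. \<phi> (card {i \<in> J - {j}. \<sigma> l \<le> \<sigma> i}))"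
    using remove(1) by (intro add_left_mono sum_mono antimonoD[OF \<open>antimono \<phi>\<close>] card_mono) auto
  also have "\<dots> \<le> \<phi> (card J) + (\<Sum>r = 1..card (J - {j}). \<phi> r)"
    using remove(4)[OF j(1)] by simp
  also have "\<dots> = (\<Sum>r = 1..card J. \<phi> r)"
    by (simp add: card)
  finally show ?case .
qed

section \<open>The ramp function: Riemann sums and convexity\<close>

text \<open>This is the function \<open>h\<close> of the proof idea, with its dependence on
  \<open>\<alpha>\<close> made explicit.\<close>

definition ramp :: "real \<Rightarrow> real \<Rightarrow> real" where
  "ramp \<alpha> p = max 0 (2 - p / \<alpha>)"

lemma ramp_nonneg [simp]: "0 \<le> ramp \<alpha> p"
  by (simp add: ramp_def)

lemma borel_measurable_ramp [measurable]: "ramp \<alpha> \<in> borel_measurable borel"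
  unfolding ramp_def by measurable

lemma ramp_antimono:
  assumes "0 < \<alpha>" "p \<le> q"
  shows "ramp \<alpha> q \<le> ramp \<alpha> p"
  using divide_right_mono[of p q \<alpha>] assms by (auto simp: ramp_def max_def)

text \<open>The primitive of \<open>- ramp \<alpha>\<close> is \<open>\<alpha> / 2 * ramp \<alpha>\<^sup>2\<close>; the lower Riemann sums of \<open>ramp \<alpha>\<close> telescope
  against it.\<close>

lemma ramp_le_primitive_diff:
  assumes "0 < \<alpha>" "a \<le> b"
  shows "(b - a) * ramp \<alpha> b \<le> \<alpha> / 2 * ((ramp \<alpha> a)\<^sup>2 - (ramp \<alpha> b)\<^sup>2)"
proof (cases "2 - b / \<alpha> \<le> 0")
  case True
  then have "ramp \<alpha> b = 0" by (simp add: ramp_def)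
  then show ?thesis using assms by simp
next
  case False
  moreover have "a / \<alpha> \<le> b / \<alpha>" using assms by (simp add: divide_right_mono)
  ultimately have r: "ramp \<alpha> a = 2 - a / \<alpha>" "ramp \<alpha> b = 2 - b / \<alpha>"
    by (auto simp: ramp_def)
  have "ramp \<alpha> a - ramp \<alpha> b = (b - a) / \<alpha>" unfolding r by (simp add: diff_divide_distrib)
  then have eq: "\<alpha> * (ramp \<alpha> a - ramp \<alpha> b) = b - a" using assms by simp
  \<comment> \<open>Both endpoints lie on the linear stretch, where the trapezoid rule is exact; the
    lower rectangle lies below the trapezoid.\<close>
  have "(b - a) * ramp \<alpha> b \<le> (b - a) * ((ramp \<alpha> a + ramp \<alpha> b) / 2)"
    using assms ramp_antimono[OF assms] by (intro mult_left_mono) auto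
  also have "\<dots> = \<alpha> / 2 * ((ramp \<alpha> a)\<^sup>2 - (ramp \<alpha> b)\<^sup>2)"
    unfolding eq[symmetric] by (simp add: power2_eq_square field_simps)
  finally show ?thesis .
qed

lemma sum_ramp_le:
  assumes "0 < \<alpha>" "0 < N"
  shows "(\<Sum>r = 1..N. ramp \<alpha> (real r / real N)) \<le> 2 * \<alpha> * real N"
proof -
  let ?H = "\<lambda>r::nat. (ramp \<alpha> (real r / real N))\<^sup>2"
  have step: "ramp \<alpha> (real (Suc r) / real N) \<le> real N * \<alpha> / 2 * (?H r - ?H (Suc r))" for r
  proof -
    have "real (Suc r) / N - real r / N = 1 / N" by (simp add: diff_divide_distrib[symmetric])
    moreover have "real r / N \<le> real (Suc r) / N" by (simp add: divide_right_mono)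
    ultimately have "1 / N * ramp \<alpha> (real (Suc r) / real N) \<le> \<alpha> / 2 * (?H r - ?H (Suc r))"
      using ramp_le_primitive_diff[OF assms(1)] by metis
    then have "N * (1 / N * ramp \<alpha> (real (Suc r) / real N)) \<le> N * (\<alpha> / 2 * (?H r - ?H (Suc r)))"
      by (intro mult_left_mono) auto
    then show ?thesis using assms by (simp add: mult.assoc)
  qed
  have "(\<Sum>r = 1..N. ramp \<alpha> (real r / real N)) = (\<Sum>r<N. ramp \<alpha> (real (Suc r) / real N))"
    by (simp add: sum.atLeast1_atMost_eq del: of_nat_Suc)
  also have "\<dots> \<le> (\<Sum>r<N. real N * \<alpha> / 2 * (?H r - ?H (Suc r)))"
    by (intro sum_mono step)
  also have "\<dots> = real N * \<alpha> / 2 * (?H 0 - ?H N)"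
    using sum_lessThan_telescope'[of ?H N] by (simp only: sum_distrib_left[symmetric])
  \<comment> \<open>The constant 4 is \<open>(ramp \<alpha> 0)\<^sup>2\<close>; the nonnegative
    \<open>?H N\<close> is dropped.\<close>
  also have "\<dots> \<le> real N * \<alpha> / 2 * 4"
    using assms by (intro mult_left_mono) (auto simp: ramp_def)
  finally show ?thesis by (simp add: mult_ac)
qed

text \<open>Jensen's inequality for a maximum of two affine functions: each branch of the maximum at
  the mean is below the mean of the ramps, the affine one because it commutes with means, the zero
  one by nonnegativity.\<close>

lemma ramp_mean_le:
  assumes "0 < K"
  shows "ramp \<alpha> (1 / real K * (\<Sum>k = 1..K. p k)) \<le> 1 / real K * (\<Sum>k = 1..K. ramp \<alpha> (p k))"
proof -
  have "2 - 1 / real K * (\<Sum>k = 1..K. p k) / \<alpha> = 1 / real K * (\<Sum>k = 1..K. 2 - p k / \<alpha>)"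
    using assms by (simp add: sum_subtractf sum_divide_distrib[symmetric] field_simps)
  also have "\<dots> \<le> 1 / real K * (\<Sum>k = 1..K. ramp \<alpha> (p k))"
    by (intro mult_left_mono sum_mono) (auto simp: ramp_def)
  finally show ?thesis
    by (subst ramp_def) (auto intro!: divide_nonneg_nonneg sum_nonneg)
qed

section \<open>The uniform threshold and independence\<close>

lemma emeasure_uniform_threshold_le:
  assumes "0 < \<alpha>"
  shows "emeasure (uniform_measure lborel {0<..<1::real}) {u. q \<le> \<alpha> * (2 - u)} \<le> ennreal (ramp \<alpha> q)"
proof -
  have iff: "q \<le> \<alpha> * (2 - u) \<longleftrightarrow> u \<le> 2 - q / \<alpha>" for u
    using assms by (auto simp: field_simps)
  have "emeasure (uniform_measure lborel {0<..<1::real}) {u. q \<le> \<alpha> * (2 - u)}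
      = emeasure lborel ({0<..<1} \<inter> {..2 - q / \<alpha>})"
    by (subst emeasure_uniform_measure) (auto simp: iff atMost_def divide_ennreal_def)
  \<comment> \<open>Giving up the cutoff at 1 trades the clamped length for the convex ramp.\<close>
  also have "\<dots> \<le> emeasure lborel {0..ramp \<alpha> q}"
    by (intro emeasure_mono) (auto simp: ramp_def)
  finally show ?thesis by simp
qed

text \<open>Independence is agreement of the joint law with the product law on rectangles, which
  determine it. This is what permits integrating out \<open>U\<close>, the data and the folds one
  after the other.\<close>

lemma (in prob_space) distr_pair_eq_if_indep_elements:
  assumes "indep_elements M S A T B"
  shows "distr M (S \<Otimes>\<^sub>M T) (\<lambda>\<omega>. (A \<omega>, B \<omega>)) = distr M S A \<Otimes>\<^sub>M distr M T B"
proof -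
  have [measurable]: "A \<in> measurable M S" "B \<in> measurable M T"
    and ind: "indep_set {A -` E \<inter> space M | E. E \<in> sets S} {B -` F \<inter> space M | F. F \<in> sets T}"
    using assms by (auto simp: indep_elements_def)
  interpret A: prob_space "distr M S A" by (rule prob_space_distr) simp
  interpret B: prob_space "distr M T B" by (rule prob_space_distr) simp
  show ?thesis
  proof (rule pair_measure_eqI[symmetric])
    fix E F assume "E \<in> sets (distr M S A)" "F \<in> sets (distr M T B)"
    then have [measurable]: "E \<in> sets S" "F \<in> sets T" by auto
    have "prob ((A -` E \<inter> space M) \<inter> (B -` F \<inter> space M))
        = prob (A -` E \<inter> space M) * prob (B -` F \<inter> space M)"
      by (rule indep_setD[OF ind]) auto
    moreover have "(\<lambda>\<omega>. (A \<omega>, B \<omega>)) -` (E \<times> F) \<inter> space M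
        = (A -` E \<inter> space M) \<inter> (B -` F \<inter> space M)" by auto
    ultimately show "emeasure (distr M S A) E * emeasure (distr M T B) F
        = emeasure (distr M (S \<Otimes>\<^sub>M T) (\<lambda>\<omega>. (A \<omega>, B \<omega>))) (E \<times> F)"
      by (simp add: emeasure_distr emeasure_eq_measure ennreal_mult)
  qed (auto intro: A.sigma_finite_measure_axioms B.sigma_finite_measure_axioms)
qed

section \<open>p-values of a single fold\<close>

text \<open>The candidate test point is an arbitrary index \<open>j\<close>; the cross-conformal p-value at the true
  response is the case \<open>j = n + 1\<close>, whose comparison with itself supplies the summand 1.\<close>

definition fold_pvalue ::
    "('x \<times> 'y \<Rightarrow> ('x \<times> 'y) list \<Rightarrow> real) \<Rightarrow> nat \<Rightarrow> nat set \<Rightarrow> nat \<Rightarrow>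
     (nat \<Rightarrow> 'x \<times> 'y) \<Rightarrow> real" where
  "fold_pvalue s n F j z =
     (\<Sum>i\<in>insert (n + 1) F. of_bool (s (z j) (dataset z ({1..n} - F)) \<le> s (z i) (dataset z ({1..n} - F))))
     / (real (card F) + 1)"

lemma dataset_cong:
  assumes "finite J" "\<And>i. i \<in> J \<Longrightarrow> z i = z' i"
  shows "dataset z J = dataset z' J"
  using assms by (auto simp: dataset_def)

lemma fold_pvalue_cong:
  assumes "F \<subseteq> {1..n}" "j \<in> {1..n + 1}" "\<And>i. i \<in> {1..n + 1} \<Longrightarrow> z i = z' i"
  shows "fold_pvalue s n F j z = fold_pvalue s n F j z'"
proof -
  have "dataset z ({1..n} - F) = dataset z' ({1..n} - F)"
    by (rule dataset_cong) (auto intro!: assms(3))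
  then show ?thesis
    using assms by (auto simp: fold_pvalue_def intro!: arg_cong2[where f = "(/)"] sum.cong)
qed

lemma equal_folds_fold_index:
  assumes "equal_folds n K f" "k \<in> {1..K}" "i \<in> f k"
  shows "fold_index K f i = k"
  unfolding fold_index_def
  using assms unfolding equal_folds_def disjoint_family_on_def
  by (intro the_equality) blast+

lemma equal_folds_subset: "equal_folds n K f \<Longrightarrow> k \<in> {1..K} \<Longrightarrow> f k \<subseteq> {1..n}"
  by (auto simp: equal_folds_def)

text \<open>Properness makes the training set of each fold nonempty, and
  \<open>score_measurable\<close> speaks only of datasets of size at least 1.\<close>

lemma equal_folds_psubset:
  assumes "equal_folds n K f" "k \<in> {1..K}" "n > 0" "K \<ge> 2"
  shows "f k \<subset> {1..n}"
proof -
  have "card (f k) < n" using assms by (auto simp: equal_folds_def)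
  then show ?thesis using equal_folds_subset[OF assms(1,2)] by auto
qed

lemma equal_folds_restrict: "equal_folds n K (restrict f {1..K}) \<longleftrightarrow> equal_folds n K f"
  by (simp add: equal_folds_def disjoint_family_on_def)

text \<open>Every point of fold \<open>k\<close> has \<open>fold_index\<close> equal to
  \<open>k\<close>, so its cross-validation score is computed from the same training set as the
  candidate's.\<close>

lemma cross_pvalue_eq_fold_pvalue:
  assumes "equal_folds n K f" "k \<in> {1..K}"
  shows "cross_pvalue s n K f z k (snd (z (n + 1))) = fold_pvalue s n (f k) (n + 1) z"
proof -
  have "n + 1 \<notin> f k" "finite (f k)"
    using equal_folds_subset[OF assms] finite_subset by fastforce+
  moreover have "card (f k) = n div K" using assms by (simp add: equal_folds_def)
  ultimately show ?thesis
    using equal_folds_fold_index[OF assms]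
    by (simp add: cross_pvalue_def fold_pvalue_def cv_score_def)
qed

text \<open>For fixed \<open>F\<close> the dataset has constant length, so the map factors through a
  selection of coordinates into the product space of \<open>score_measurable\<close>.\<close>

lemma measurable_score_dataset:
  assumes "score_measurable MX MY s" "F \<subset> {1..n}" "i \<in> {1..n + 1}"
  shows "(\<lambda>z. s (z i) (dataset z ({1..n} - F))) \<in> borel_measurable (data_space MX MY n)"
proof -
  let ?l = "sorted_list_of_set ({1..n} - F)"
  have len: "1 \<le> length ?l" using assms(2) by (auto simp: card_gt_0_iff Suc_le_eq)
  have nth: "?l ! j \<in> {1..n + 1}" if "j < length ?l" for j
    using nth_mem[OF that] by auto
  have "(\<lambda>z. (z i, \<lambda>j\<in>{0..<length ?l}. z (?l ! j)))
      \<in> measurable (data_space MX MY n) ((MX \<Otimes>\<^sub>M MY) \<Otimes>\<^sub>M (\<Pi>\<^sub>M j\<in>{0..<length ?l}. MX \<Otimes>\<^sub>M MY))"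
    using assms(3) nth
    by (intro measurable_Pair measurable_restrict measurable_component_singleton) auto
  moreover have "(\<lambda>(p, w). s p (map w [0..<length ?l]))
      \<in> borel_measurable ((MX \<Otimes>\<^sub>M MY) \<Otimes>\<^sub>M (\<Pi>\<^sub>M j\<in>{0..<length ?l}. MX \<Otimes>\<^sub>M MY))"
    using assms(1) len unfolding score_measurable_def by blast
  ultimately have "(\<lambda>(p, w). s p (map w [0..<length ?l])) \<circ> (\<lambda>z. (z i, \<lambda>j\<in>{0..<length ?l}. z (?l ! j)))
      \<in> borel_measurable (data_space MX MY n)"
    by (rule measurable_comp)
  moreover have "map (\<lambda>j\<in>{0..<length ?l}. z (?l ! j)) [0..<length ?l] = dataset z ({1..n} - F)"
    for z :: "nat \<Rightarrow> 'a \<times> 'b"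
    unfolding dataset_def by (rule nth_equalityI) auto
  ultimately show ?thesis by (simp add: comp_def)
qed

lemma borel_measurable_fold_pvalue:
  assumes "score_measurable MX MY s" "F \<subset> {1..n}" "j \<in> {1..n + 1}"
  shows "fold_pvalue s n F j \<in> borel_measurable (data_space MX MY n)"
proof -
  have score: "(\<lambda>z. s (z i) (dataset z ({1..n} - F))) \<in> borel_measurable (data_space MX MY n)"
    if "i \<in> insert j (insert (n + 1) F)" for i
    using that assms by (intro measurable_score_dataset) auto
  show ?thesis
    unfolding fold_pvalue_def of_bool_def
    by (intro borel_measurable_divide borel_measurable_sum measurable_If borel_measurable_const
        borel_measurable_le score) auto
qed

text \<open>A pointwise bound: for fixed data all candidates share one training set, so their
  p-values are ranks divided by \<open>card F + 1\<close>, and the rank lemma reduces the sum to the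
  Riemann sum.\<close>

lemma sum_ramp_fold_pvalue_le:
  assumes "0 < \<alpha>" "F \<subseteq> {1..n}"
  shows "(\<Sum>j\<in>insert (n + 1) F. ramp \<alpha> (fold_pvalue s n F j z)) \<le> 2 * \<alpha> * (real (card F) + 1)"
proof -
  have fin: "finite F" using assms(2) finite_subset by blast
  have "n + 1 \<notin> F" using assms(2) by auto
  then have card: "card (insert (n + 1) F) = card F + 1" using fin by simp
  let ?N = "card F + 1" and ?\<sigma> = "\<lambda>i. s (z i) (dataset z ({1..n} - F))"
  have "fold_pvalue s n F j z = real (card {i \<in> insert (n + 1) F. ?\<sigma> j \<le> ?\<sigma> i}) / ?N" for j
    using fin unfolding fold_pvalue_def by (subst sum_of_bool_eq) (auto simp: Int_def)
  moreover have "antimono (\<lambda>r. ramp \<alpha> (real r / ?N))"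
    using assms(1) by (intro antimonoI ramp_antimono divide_right_mono) auto
  ultimately have "(\<Sum>j\<in>insert (n + 1) F. ramp \<alpha> (fold_pvalue s n F j z))
      \<le> (\<Sum>r = 1..?N. ramp \<alpha> (real r / ?N))"
    using sum_rank_le[of "insert (n + 1) F" "\<lambda>r. ramp \<alpha> (real r / ?N)" ?\<sigma>] fin card by simp
  also have "\<dots> \<le> 2 * \<alpha> * ?N" using assms(1) by (intro sum_ramp_le) auto
  finally show ?thesis by (simp add: algebra_simps)
qed

text \<open>Exchanging the test point with a point of the fold does not change the training set of that
  fold.\<close>

lemma fold_pvalue_transpose:
  assumes "F \<subseteq> {1..n}" "j \<in> insert (n + 1) F"
  shows "fold_pvalue s n F (n + 1) (\<lambda>i\<in>{1..n + 1}. z (Transposition.transpose j (n + 1) i)) = fold_pvalue s n F j z"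
    (is "fold_pvalue s n F (n + 1) ?z = _")
proof -
  let ?\<tau> = "Transposition.transpose j (n + 1)" and ?J = "insert (n + 1) F"
  have "?\<tau> i = i" if "i \<in> {1..n} - F" for i
    using that assms(2) by (auto simp: Transposition.transpose_def)
  then have ds: "dataset ?z ({1..n} - F) = dataset z ({1..n} - F)"
    by (intro dataset_cong) auto
  have z: "?z i = z (?\<tau> i)" if "i \<in> ?J" for i
    using that assms(1) by auto
  \<comment> \<open>The swap maps the comparison set onto itself, so it only reorders the sum of
    indicators.\<close>
  have \<tau>: "?\<tau> permutes ?J" using assms(2) by (intro permutes_swap_id) auto
  let ?le = "\<lambda>p. of_bool (s (z j) (dataset z ({1..n} - F)) \<le> s p (dataset z ({1..n} - F))) :: real"
  have "(\<Sum>i\<in>?J. ?le (?z i)) = (\<Sum>i\<in>?J. ?le (z (?\<tau> i)))"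
    by (intro sum.cong refl) (simp only: z)
  also have "\<dots> = (\<Sum>i\<in>?J. ?le (z i))"
    using sum.permute[OF \<tau>, of "\<lambda>i. ?le (z i)"] by (simp only: comp_def)
  finally have "(\<Sum>i\<in>?J. ?le (?z i)) = (\<Sum>i\<in>?J. ?le (z i))" .
  moreover have "?z (n + 1) = z j" by (subst z) auto
  ultimately show ?thesis
    unfolding fold_pvalue_def ds by (simp only:)
qed

section \<open>Expected ramp of one fold p-value\<close>

lemma nn_integral_ramp_fold_pvalue_le:
  assumes D: "prob_space D" "sets D = sets (data_space MX MY n)"
    and inv: "\<And>\<pi>. \<pi> permutes {1..n + 1} \<Longrightarrow>
      distr D (data_space MX MY n) (\<lambda>z. \<lambda>i\<in>{1..n + 1}. z (\<pi> i)) = D"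
    and s: "score_measurable MX MY s" and F: "F \<subset> {1..n}" and \<alpha>: "0 < \<alpha>"
  shows "(\<integral>\<^sup>+z. ennreal (ramp \<alpha> (fold_pvalue s n F (n + 1) z)) \<partial>D) \<le> ennreal (2 * \<alpha>)"
proof -
  interpret prob_space D by (rule D(1))
  let ?J = "insert (n + 1) F" and ?N = "real (card F) + 1"
  let ?E = "\<lambda>j. \<integral>\<^sup>+z. ennreal (ramp \<alpha> (fold_pvalue s n F j z)) \<partial>D"
  have fin: "finite F" using F finite_subset by blast
  have "n + 1 \<notin> F" using F by auto
  then have card: "card ?J = card F + 1" using fin by simp
  note meas = measurable_cong_sets[OF D(2) refl]
  have [measurable]: "fold_pvalue s n F j \<in> borel_measurable D" if "j \<in> ?J" for j
    using that F by (subst meas, intro borel_measurable_fold_pvalue[OF s]) auto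
  \<comment> \<open>The law \<open>D\<close> is replaced by its image under the swap of
    \<open>j\<close> and \<open>n + 1\<close>; the change of variables then puts \<open>j\<close> in
    the role of the candidate.\<close>
  have swap: "?E j = ?E (n + 1)" if j: "j \<in> ?J" for j
  proof -
    let ?\<tau> = "Transposition.transpose j (n + 1)"
    let ?T = "\<lambda>z. \<lambda>i\<in>{1..n + 1}. z (?\<tau> i)"
    have \<tau>: "?\<tau> permutes {1..n + 1}" using j F by (intro permutes_swap_id) auto
    have T: "?T \<in> measurable D (data_space MX MY n)"
      unfolding meas using permutes_in_image[OF \<tau>]
      by (intro measurable_restrict measurable_component_singleton) auto
    have "?E (n + 1)
        = (\<integral>\<^sup>+z. ennreal (ramp \<alpha> (fold_pvalue s n F (n + 1) z)) \<partial>distr D (data_space MX MY n) ?T)"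
      unfolding inv[OF \<tau>] ..
    also have "\<dots> = (\<integral>\<^sup>+z. ennreal (ramp \<alpha> (fold_pvalue s n F (n + 1) (?T z))) \<partial>D)"
      using borel_measurable_fold_pvalue[OF s F, of "n + 1"]
      by (intro nn_integral_distr T) auto
    also have "\<dots> = ?E j"
      using fold_pvalue_transpose[of F n j s] F j by (intro nn_integral_cong) auto
    finally show ?thesis ..
  qed
  \<comment> \<open>Multiplying by the number of candidates replaces averaging; this positive finite
    factor is cancelled at the end.\<close>
  have "ennreal ?N * ?E (n + 1) = (\<Sum>j\<in>?J. ?E (n + 1))"
    unfolding sum_constant card by (simp add: ennreal_of_nat_eq_real_of_nat add.commute)
  also have "\<dots> = (\<Sum>j\<in>?J. ?E j)"
    by (intro sum.cong refl swap[symmetric])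
  also have "\<dots> = (\<integral>\<^sup>+z. (\<Sum>j\<in>?J. ennreal (ramp \<alpha> (fold_pvalue s n F j z))) \<partial>D)"
    by (intro nn_integral_sum[symmetric]) auto
  also have "\<dots> = (\<integral>\<^sup>+z. ennreal (\<Sum>j\<in>?J. ramp \<alpha> (fold_pvalue s n F j z)) \<partial>D)"
    by (simp only: sum_ennreal ramp_nonneg)
  also have "\<dots> \<le> (\<integral>\<^sup>+z. ennreal (2 * \<alpha> * ?N) \<partial>D)"
    using F by (intro nn_integral_mono ennreal_leI sum_ramp_fold_pvalue_le \<alpha>) auto
  also have "\<dots> = ennreal ?N * ennreal (2 * \<alpha>)"
    using \<alpha> by (simp add: emeasure_space_1 ennreal_mult[symmetric] mult.commute del: ennreal_plus)
  finally show ?thesis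
    by (subst (asm) ennreal_mult_le_mult_iff) (auto simp: ennreal_eq_0_iff)
qed

section \<open>The mean p-value at the true response\<close>

definition mean_pvalue ::
    "('x \<times> 'y \<Rightarrow> ('x \<times> 'y) list \<Rightarrow> real) \<Rightarrow> nat \<Rightarrow> nat \<Rightarrow> (nat \<Rightarrow> nat set) \<Rightarrow>
     (nat \<Rightarrow> 'x \<times> 'y) \<Rightarrow> real" where
  "mean_pvalue s n K f z = 1 / real K * (\<Sum>k = 1..K. fold_pvalue s n (f k) (n + 1) z)"

text \<open>Independence is stated for \<open>data\<close> and \<open>folds\<close>, which are
  restricted to their index sets; this carries the mean p-value over to them.\<close>

lemma mean_pvalue_restrict:
  assumes "equal_folds n K f"
  shows "mean_pvalue s n K (restrict f {1..K}) (restrict z {1..n + 1}) = mean_pvalue s n K f z"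
  unfolding mean_pvalue_def
proof (intro arg_cong2[where f = "(*)"] sum.cong refl)
  fix k assume k: "k \<in> {1..K}"
  show "fold_pvalue s n (restrict f {1..K} k) (n + 1) (restrict z {1..n + 1}) = fold_pvalue s n (f k) (n + 1) z"
    using k by (simp only: restrict_apply if_True, intro fold_pvalue_cong equal_folds_subset[OF assms]) auto
qed

lemma mem_u_mod_cross_set_iff:
  assumes "equal_folds n K f" "snd (z (n + 1)) \<in> space MY"
  shows "snd (z (n + 1)) \<in> u_mod_cross_set MY s n K \<alpha> f z u
    \<longleftrightarrow> \<alpha> < 1 / (2 - u) * mean_pvalue s n K f z"
proof -
  have "(\<Sum>k = 1..K. cross_pvalue s n K f z k (snd (z (n + 1)))) = (\<Sum>k = 1..K. fold_pvalue s n (f k) (n + 1) z)"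
    by (intro sum.cong refl cross_pvalue_eq_fold_pvalue[OF assms(1)])
  then show ?thesis
    using assms(2) unfolding u_mod_cross_set_def mean_pvalue_def by simp
qed

lemma borel_measurable_mean_pvalue:
  assumes "score_measurable MX MY s" "equal_folds n K f" "n > 0" "K \<ge> 2"
  shows "mean_pvalue s n K f \<in> borel_measurable (data_space MX MY n)"
  unfolding mean_pvalue_def
  using equal_folds_psubset[OF assms(2) _ assms(3,4)]
  by (intro borel_measurable_times borel_measurable_const borel_measurable_sum
      borel_measurable_fold_pvalue assms(1)) auto

text \<open>Convexity moves the ramp inside the mean; by linearity each fold then contributes its
  own bound of \<open>2 * \<alpha>\<close>.\<close>

lemma nn_integral_ramp_mean_pvalue_le:
  assumes D: "prob_space D" "sets D = sets (data_space MX MY n)"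
    and inv: "\<And>\<pi>. \<pi> permutes {1..n + 1} \<Longrightarrow>
      distr D (data_space MX MY n) (\<lambda>z. \<lambda>i\<in>{1..n + 1}. z (\<pi> i)) = D"
    and s: "score_measurable MX MY s" and f: "equal_folds n K f" "n > 0" "K \<ge> 2" and \<alpha>: "0 < \<alpha>"
  shows "(\<integral>\<^sup>+z. ennreal (ramp \<alpha> (mean_pvalue s n K f z)) \<partial>D) \<le> ennreal (2 * \<alpha>)"
proof -
  note F = equal_folds_psubset[OF f(1) _ f(2,3)]
  have meas: "(\<lambda>z. ennreal (ramp \<alpha> (fold_pvalue s n (f k) (n + 1) z))) \<in> borel_measurable D"
    if "k \<in> {1..K}" for k
  proof -
    have [measurable]: "fold_pvalue s n (f k) (n + 1) \<in> borel_measurable D"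
      using borel_measurable_fold_pvalue[OF s F[OF that], of "n + 1"]
        measurable_cong_sets[OF D(2) refl] by auto
    show ?thesis by measurable
  qed
  have "(\<integral>\<^sup>+z. ennreal (ramp \<alpha> (mean_pvalue s n K f z)) \<partial>D)
      \<le> (\<integral>\<^sup>+z. ennreal (1 / real K * (\<Sum>k = 1..K. ramp \<alpha> (fold_pvalue s n (f k) (n + 1) z))) \<partial>D)"
    unfolding mean_pvalue_def using f by (intro nn_integral_mono ennreal_leI ramp_mean_le) auto
  also have "\<dots> = (\<integral>\<^sup>+z. ennreal (1 / real K) *
      (\<Sum>k = 1..K. ennreal (ramp \<alpha> (fold_pvalue s n (f k) (n + 1) z))) \<partial>D)"
    by (intro nn_integral_cong) (simp only: sum_ennreal ramp_nonneg, rule ennreal_mult, auto intro: sum_nonneg)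
  also have "\<dots> = ennreal (1 / real K) *
      (\<Sum>k = 1..K. \<integral>\<^sup>+z. ennreal (ramp \<alpha> (fold_pvalue s n (f k) (n + 1) z)) \<partial>D)"
    by (simp only: nn_integral_cmult borel_measurable_sum nn_integral_sum meas)
  also have "\<dots> \<le> ennreal (1 / real K) * (\<Sum>k = 1..K. ennreal (2 * \<alpha>))"
    using nn_integral_ramp_fold_pvalue_le[OF D inv s F \<alpha>]
    by (intro mult_left_mono sum_mono) auto
  also have "\<dots> = ennreal (1 / real K) * (ennreal (real K) * ennreal (2 * \<alpha>))"
    by (simp add: ennreal_of_nat_eq_real_of_nat)
  also have "\<dots> = ennreal (2 * \<alpha>)"
    using f(3) \<alpha> by (simp add: ennreal_mult[symmetric])
  finally show ?thesis .
qed

section \<open>Discrete folds, invariant laws and coverage\<close>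

text \<open>Being finite and discrete, the fold space allows joint measurability in data and folds
  to be checked for one fold configuration at a time.\<close>

lemma fold_space_eq_count_space:
  "fold_space n K = count_space ({1..K} \<rightarrow>\<^sub>E Pow {1..n})"
  by (rule count_space_PiM_finite) (auto intro: countable_finite)

text \<open>Permuting the coordinates of the law amounts to permuting the indices of
  \<open>Z\<close>, so exchangeability becomes the invariance used in the integral bounds.\<close>

lemma exchangeable_distr_invariant:
  assumes Z: "\<And>i. i \<in> J \<Longrightarrow> Z i \<in> measurable M N"
    and "exchangeable M N J Z" and \<pi>: "\<pi> permutes J"
  defines "D \<equiv> distr M (\<Pi>\<^sub>M i\<in>J. N) (\<lambda>\<omega>. \<lambda>i\<in>J. Z i \<omega>)"
  shows "distr D (\<Pi>\<^sub>M i\<in>J. N) (\<lambda>z. \<lambda>i\<in>J. z (\<pi> i)) = D"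
proof -
  have "distr D (\<Pi>\<^sub>M i\<in>J. N) (\<lambda>z. \<lambda>i\<in>J. z (\<pi> i))
      = distr M (\<Pi>\<^sub>M i\<in>J. N) ((\<lambda>z. \<lambda>i\<in>J. z (\<pi> i)) \<circ> (\<lambda>\<omega>. \<lambda>i\<in>J. Z i \<omega>))"
    unfolding D_def using Z permutes_in_image[OF \<pi>]
    by (intro distr_distr measurable_restrict measurable_component_singleton) auto
  also have "(\<lambda>z. \<lambda>i\<in>J. z (\<pi> i)) \<circ> (\<lambda>\<omega>. \<lambda>i\<in>J. Z i \<omega>) = (\<lambda>\<omega>. \<lambda>i\<in>J. Z (\<pi> i) \<omega>)"
    using permutes_in_image[OF \<pi>] by (auto simp: fun_eq_iff restrict_def)
  also have "distr M (\<Pi>\<^sub>M i\<in>J. N) (\<lambda>\<omega>. \<lambda>i\<in>J. Z (\<pi> i) \<omega>) = D"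
    using assms(2) \<pi> unfolding exchangeable_def D_def by blast
  finally show ?thesis .
qed

theorem theorem4p6:
  fixes M :: "'w measure"
    and MX :: "'x measure" and MY :: "'y measure"
    and X :: "nat \<Rightarrow> 'w \<Rightarrow> 'x" and Y :: "nat \<Rightarrow> 'w \<Rightarrow> 'y"
    and U :: "'w \<Rightarrow> real"
    and I :: "'w \<Rightarrow> nat \<Rightarrow> nat set"
    and s :: "'x \<times> 'y \<Rightarrow> ('x \<times> 'y) list \<Rightarrow> real"
    and n K :: nat and \<alpha> :: real
  defines "Z \<equiv> \<lambda>i \<omega>. (X i \<omega>, Y i \<omega>)"
  defines "data \<equiv> \<lambda>\<omega>. \<lambda>i\<in>{1..n + 1}. Z i \<omega>"
    and "folds \<equiv> \<lambda>\<omega>. \<lambda>k\<in>{1..K}. I \<omega> k"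
  assumes "prob_space M"
    and "\<And>i. i \<in> {1..n + 1} \<Longrightarrow> X i \<in> measurable M MX"
    and "\<And>i. i \<in> {1..n + 1} \<Longrightarrow> Y i \<in> measurable M MY"
    and "score_measurable MX MY s" and "score_symmetric MX MY s"
    and "n > 0" and "K \<ge> 2" and "K dvd n"
    and "\<And>\<omega>. \<omega> \<in> space M \<Longrightarrow> equal_folds n K (I \<omega>)"
    and "indep_elements M (data_space MX MY n) data (fold_space n K) folds"
    and "\<And>\<omega>. \<omega> \<in> space M \<Longrightarrow> U \<omega> \<in> {0<..<1}"
    and "distr M borel U = uniform_measure lborel {0<..<1}"
    and "indep_elements M borel U (data_space MX MY n \<Otimes>\<^sub>M fold_space n K)
           (\<lambda>\<omega>. (data \<omega>, folds \<omega>))"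
    and "0 < \<alpha>" and "\<alpha> < 1"
  shows "(\<forall>\<omega>\<in>space M. u_mod_cross_set MY s n K \<alpha> (I \<omega>) (\<lambda>i. Z i \<omega>) (U \<omega>)
              \<subseteq> mod_cross_set MY s n K \<alpha> (I \<omega>) (\<lambda>i. Z i \<omega>)) \<and>
         (exchangeable M (MX \<Otimes>\<^sub>M MY) {1..n + 1} Z \<longrightarrow>
            measure M {\<omega> \<in> space M.
              Y (n + 1) \<omega> \<in> u_mod_cross_set MY s n K \<alpha> (I \<omega>) (\<lambda>i. Z i \<omega>) (U \<omega>)}
            \<ge> 1 - 2 * \<alpha>)"
proof -
  interpret prob_space M by fact
  note X = assms(5) and Y = assms(6) and s = assms(7) and nK = \<open>n > 0\<close> \<open>K \<ge> 2\<close>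
    and folds = assms(12) and U01 = assms(14)
  let ?DS = "data_space MX MY n" and ?FS = "fold_space n K"
  define p where "p \<omega> = mean_pvalue s n K (I \<omega>) (\<lambda>i. Z i \<omega>)" for \<omega>
  have Z: "Z i \<in> measurable M (MX \<Otimes>\<^sub>M MY)" if "i \<in> {1..n + 1}" for i
    unfolding Z_def using X[OF that] Y[OF that] by measurable
  have mem: "Y (n + 1) \<omega> \<in> u_mod_cross_set MY s n K \<alpha> (I \<omega>) (\<lambda>i. Z i \<omega>) (U \<omega>)
      \<longleftrightarrow> \<not> p \<omega> \<le> \<alpha> * (2 - U \<omega>)" if \<omega>: "\<omega> \<in> space M" for \<omega>
  proof -
    have "Y (n + 1) \<omega> \<in> space MY" using measurable_space[OF Y \<omega>] by simp
    then show ?thesis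
      using mem_u_mod_cross_set_iff[OF folds[OF \<omega>], of "\<lambda>i. Z i \<omega>" MY s \<alpha> "U \<omega>"] U01[OF \<omega>]
      by (auto simp: Z_def p_def field_simps not_le)
  qed
  have subset: "u_mod_cross_set MY s n K \<alpha> (I \<omega>) (\<lambda>i. Z i \<omega>) (U \<omega>)
      \<subseteq> mod_cross_set MY s n K \<alpha> (I \<omega>) (\<lambda>i. Z i \<omega>)" if \<omega>: "\<omega> \<in> space M" for \<omega>
  proof -
    \<comment> \<open>Since \<open>U \<omega> < 1\<close>, the factor is less than 1, so it can only
      shrink a nonnegative mean p-value.\<close>
    have "1 / (2 - U \<omega>) * q \<le> q" if "0 \<le> q" for q
      using U01[OF \<omega>] that by (simp add: field_simps mult_left_le)
    moreover have "0 \<le> 1 / real K * (\<Sum>k = 1..K. cross_pvalue s n K (I \<omega>) (\<lambda>i. Z i \<omega>) k y)" for y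
      by (auto simp: cross_pvalue_def intro!: mult_nonneg_nonneg divide_nonneg_nonneg sum_nonneg add_nonneg_nonneg)
    ultimately show ?thesis
      unfolding u_mod_cross_set_def mod_cross_set_def by (blast intro: less_le_trans)
  qed
  have coverage: "1 - 2 * \<alpha> \<le> prob {\<omega> \<in> space M.
      Y (n + 1) \<omega> \<in> u_mod_cross_set MY s n K \<alpha> (I \<omega>) (\<lambda>i. Z i \<omega>) (U \<omega>)}"
    if exch: "exchangeable M (MX \<Otimes>\<^sub>M MY) {1..n + 1} Z"
  proof -
    let ?W = "\<lambda>\<omega>. (data \<omega>, folds \<omega>)"
    have meas [measurable]: "data \<in> measurable M ?DS" "folds \<in> measurable M ?FS" "U \<in> borel_measurable M"
      using assms(13,16) by (auto simp: indep_elements_def)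
    \<comment> \<open>Outside the valid fold configurations, a null set, the mean p-value need not be measurable;
      the value \<open>2 * \<alpha>\<close> is a zero of the ramp.\<close>
    define Q where "Q f z = (if equal_folds n K f then mean_pvalue s n K f z else 2 * \<alpha>)" for f z
    have Qz [measurable]: "Q f \<in> borel_measurable ?DS" for f
      unfolding Q_def using borel_measurable_mean_pvalue[OF s _ nK, of f] by (cases "equal_folds n K f") auto
    have "(\<lambda>(f, z). Q f z) \<in> borel_measurable (?FS \<Otimes>\<^sub>M ?DS)"
      unfolding fold_space_eq_count_space
      by (rule measurable_pair_measure_countable1) (use Qz in \<open>auto intro!: countable_finite finite_PiE\<close>)
    then have Q [measurable]: "(\<lambda>(z, f). Q f z) \<in> borel_measurable (?DS \<Otimes>\<^sub>M ?FS)"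
      by (subst measurable_pair_swap_iff) (simp add: split_beta')
    have p: "p \<omega> = (\<lambda>(z, f). Q f z) (?W \<omega>)" if \<omega>: "\<omega> \<in> space M" for \<omega>
      using mean_pvalue_restrict[OF folds[OF \<omega>], of s "\<lambda>i. Z i \<omega>"] folds[OF \<omega>]
        equal_folds_restrict[of n K "I \<omega>"]
      by (simp add: p_def Q_def data_def folds_def)
    interpret D: prob_space "distr M ?DS data" by (rule prob_space_distr) (rule meas)
    interpret F: prob_space "distr M ?FS folds" by (rule prob_space_distr) (rule meas)
    interpret U: prob_space "distr M borel U" by (rule prob_space_distr) (rule meas)
    interpret W: prob_space "distr M (?DS \<Otimes>\<^sub>M ?FS) ?W"
      by (rule prob_space_distr) (intro measurable_Pair meas)
    interpret DF: pair_prob_space "distr M ?DS data" "distr M ?FS folds" ..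
    interpret UW: pair_prob_space "distr M borel U" "distr M (?DS \<Otimes>\<^sub>M ?FS) ?W" ..
    let ?S = "borel \<Otimes>\<^sub>M (?DS \<Otimes>\<^sub>M ?FS)"
    have UW [measurable]: "(\<lambda>\<omega>. (U \<omega>, ?W \<omega>)) \<in> measurable M ?S"
      by (intro measurable_Pair meas)
    define B where "B = {x \<in> space ?S. (\<lambda>(z, f). Q f z) (snd x) \<le> \<alpha> * (2 - fst x)}"
    have B: "B \<in> sets ?S" unfolding B_def by measurable
    define E where "E = {\<omega> \<in> space M. p \<omega> \<le> \<alpha> * (2 - U \<omega>)}"
    have E_eq: "E = (\<lambda>\<omega>. (U \<omega>, ?W \<omega>)) -` B \<inter> space M"
      using measurable_space[OF UW] p unfolding E_def B_def by auto
    have "E \<in> sets M" unfolding E_eq by (rule measurable_sets[OF UW B])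
    have ramp_Q: "(\<lambda>w. ennreal (ramp \<alpha> ((\<lambda>(z, f). Q f z) w)))
        \<in> borel_measurable (distr M ?DS data \<Otimes>\<^sub>M distr M ?FS folds)"
      unfolding measurable_cong_sets[OF sets_pair_measure_cong[OF sets_distr sets_distr] refl]
      by measurable
    \<comment> \<open>The folds are frozen at \<open>f\<close>; as they are independent of the data,
      the integral is still against the exchangeable law of the data.\<close>
    have inner: "(\<integral>\<^sup>+z. ennreal (ramp \<alpha> (Q f z)) \<partial>distr M ?DS data) \<le> ennreal (2 * \<alpha>)" for f
    proof (cases "equal_folds n K f")
      case True
      have inv: "distr (distr M ?DS data) ?DS (\<lambda>z. \<lambda>i\<in>{1..n + 1}. z (\<pi> i)) = distr M ?DS data"
        if "\<pi> permutes {1..n + 1}" for \<pi>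
        unfolding data_def by (rule exchangeable_distr_invariant[OF Z exch that])
      show ?thesis
        using nn_integral_ramp_mean_pvalue_le[OF D.prob_space_axioms sets_distr inv s True nK \<open>0 < \<alpha>\<close>] True
        by (simp add: Q_def)
    next
      case False
      then show ?thesis using \<open>0 < \<alpha>\<close> by (simp add: Q_def ramp_def)
    qed
    have "emeasure M E = emeasure (distr M ?S (\<lambda>\<omega>. (U \<omega>, ?W \<omega>))) B"
      unfolding E_eq by (rule emeasure_distr[OF UW B, symmetric])
    also have "\<dots> = emeasure (distr M borel U \<Otimes>\<^sub>M distr M (?DS \<Otimes>\<^sub>M ?FS) ?W) B"
      using distr_pair_eq_if_indep_elements[OF assms(16)] by simp
    \<comment> \<open>Data and folds are held fixed and \<open>U\<close> is integrated first: each
      slice of \<open>B\<close> is a threshold event for \<open>U\<close>.\<close>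
    also have "\<dots> = (\<integral>\<^sup>+w. emeasure (distr M borel U) ((\<lambda>u. (u, w)) -` B) \<partial>distr M (?DS \<Otimes>\<^sub>M ?FS) ?W)"
      by (rule UW.emeasure_pair_measure_alt2) (use B in simp)
    also have "\<dots> \<le> (\<integral>\<^sup>+w. ennreal (ramp \<alpha> ((\<lambda>(z, f). Q f z) w)) \<partial>distr M (?DS \<Otimes>\<^sub>M ?FS) ?W)"
    proof (rule nn_integral_mono)
      fix w assume "w \<in> space (distr M (?DS \<Otimes>\<^sub>M ?FS) ?W)"
      then have "(\<lambda>u. (u, w)) -` B = {u. (\<lambda>(z, f). Q f z) w \<le> \<alpha> * (2 - u)}"
        by (auto simp: B_def space_pair_measure)
      then show "emeasure (distr M borel U) ((\<lambda>u. (u, w)) -` B) \<le> ennreal (ramp \<alpha> ((\<lambda>(z, f). Q f z) w))"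
        using emeasure_uniform_threshold_le[OF \<open>0 < \<alpha>\<close>] by (simp add: assms(15))
    qed
    also have "\<dots> = (\<integral>\<^sup>+w. ennreal (ramp \<alpha> ((\<lambda>(z, f). Q f z) w))
        \<partial>(distr M ?DS data \<Otimes>\<^sub>M distr M ?FS folds))"
      using distr_pair_eq_if_indep_elements[OF assms(13)] by simp
    also have "\<dots> = (\<integral>\<^sup>+f. (\<integral>\<^sup>+z. ennreal (ramp \<alpha> (Q f z)) \<partial>distr M ?DS data) \<partial>distr M ?FS folds)"
      by (subst DF.nn_integral_snd[OF ramp_Q, symmetric]) simp
    also have "\<dots> \<le> (\<integral>\<^sup>+f. ennreal (2 * \<alpha>) \<partial>distr M ?FS folds)"
      by (intro nn_integral_mono inner)
    also have "\<dots> = ennreal (2 * \<alpha>)"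
      using F.emeasure_space_1 by simp
    finally have "prob E \<le> 2 * \<alpha>"
      using \<open>0 < \<alpha>\<close> by (simp add: emeasure_eq_measure)
    moreover have "{\<omega> \<in> space M. Y (n + 1) \<omega> \<in> u_mod_cross_set MY s n K \<alpha> (I \<omega>) (\<lambda>i. Z i \<omega>) (U \<omega>)}
        = space M - E"
      using mem by (auto simp: E_def)
    ultimately show ?thesis using prob_compl[OF \<open>E \<in> sets M\<close>] by simp
  qed
  show ?thesis using subset coverage by blast
qed

end
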